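(* Let $E$ be a finite nonempty set. Every CAR mechanism on $E$ is a mixture of extreme CAR mechanisms on $E$; that is, for every CAR mechanism $\boldsymbol{\pi}$ on $E$ there exist an integer $p\ge 1$, extreme CAR mechanisms $\boldsymbol{\pi}_1,\ldots,\boldsymbol{\pi}_p$ on $E$, and a probability vector $(\lambda_1,\ldots,\lambda_p)$ (i.e. $\lambda_i\ge 0$, $\sum_i\lambda_i=1$) such that $\boldsymbol{\pi}=\lambda_1\boldsymbol{\pi}_1+\cdots+\lambda_p\boldsymbol{\pi}_p$.
   Context: Let $E$ be a finite nonempty set with $n$ elements. A CAR (coarsening at random) mechanism on $E$ is a vector of real numbers $\boldsymbol{\pi}=(\pi_A:\varnothing\neq A\subseteq E)$, indexed by the nonempty subsets of $E$, such that $\pi_A\ge 0$ for all $A$ and $\sum_{A\ni x}\pi_A=1$ for every $x\in E$. Its support is $\{A:\pi_A>0\}$. A cover of $E$ is a collection $(A_1,\ldots,A_m)$ of distinct nonempty subsets of $E$ whose union is $E$. Its incidence matrix $M$ is the matrix with rows indexed by $x\in E$, columns indexed by $j=1,\ldots,m$, and entries $1$ if $x\in A_j$ and $0$ otherwise. If $M\mathbf{z}=\mathbf{1}$ (with $\mathbf{1}$ the all-ones vector) has a nonnegative solution $\mathbf{z}=(z_1,\ldots,z_m)$, the CAR mechanism corresponding to it is given by $\pi_{A_j}=z_j$ for $j=1,\ldots,m$ and $\pi_A=0$ for every $A$ not in the cover. A CAR mechanism $\boldsymbol{\pi}$ is called extreme if it corresponds to the incidence matrix $M$ of a cover $(A_1,\ldots,A_m)$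 of $E$ such that the equation $M\mathbf{z}=\mathbf{1}$ has a unique solution $\mathbf{z}\in\mathbb{R}^m$, and this solution is strictly positive (all $z_j>0$). *)

theory Defs
  imports Complex_Main
begin

definition nonempty_subsets :: "'a set \<Rightarrow> 'a set set" where
  "nonempty_subsets E = Pow E - {{}}"

(* A vector indexed by the nonempty subsets of E is a function on 'a set of which only the
   values on nonempty_subsets E matter: no definition below depends on the other values, and
   two such vectors are the same when they agree on nonempty_subsets E. *)

definition car_mechanism :: "'a set \<Rightarrow> ('a set \<Rightarrow> real) \<Rightarrow> bool" where
  "car_mechanism E \<pi> \<longleftrightarrow>
     (\<forall>A \<in> nonempty_subsets E. \<pi> A \<ge> 0) \<and>
     (\<forall>x \<in> E. (\<Sum>A \<in> {A \<in> nonempty_subsets E. x \<in> A}. \<pi> A) = 1)"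

definition is_cover :: "'a set \<Rightarrow> 'a set list \<Rightarrow> bool" where
  "is_cover E As \<longleftrightarrow>
     distinct As \<and> set As \<subseteq> nonempty_subsets E \<and> \<Union> (set As) = E"

(* Rows are indexed by the points of E, columns by 0, ..., length As - 1. *)

definition incidence_matrix :: "'a set list \<Rightarrow> 'a \<Rightarrow> nat \<Rightarrow> real" where
  "incidence_matrix As x j = (if x \<in> As ! j then 1 else 0)"

(* The equation M z = 1 for z in R^m, with z a list of length m, so that uniqueness of the
   solution is plain equality of lists. *)

definition solves_incidence :: "'a set \<Rightarrow> 'a set list \<Rightarrow> real list \<Rightarrow> bool" where
  "solves_incidence E As z \<longleftrightarrow>
     length z = length As \<and>
     (\<forall>x \<in> E. (\<Sum>j < length As. incidence_matrix As x j * z ! j) = 1)"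

definition corresponds_to :: "'a set \<Rightarrow> ('a set \<Rightarrow> real) \<Rightarrow> 'a set list \<Rightarrow> real list \<Rightarrow> bool" where
  "corresponds_to E \<pi> As z \<longleftrightarrow>
     (\<forall>j < length As. \<pi> (As ! j) = z ! j) \<and>
     (\<forall>A \<in> nonempty_subsets E - set As. \<pi> A = 0)"

definition extreme_car_mechanism :: "'a set \<Rightarrow> ('a set \<Rightarrow> real) \<Rightarrow> bool" where
  "extreme_car_mechanism E \<pi> \<longleftrightarrow>
     car_mechanism E \<pi> \<and>
     (\<exists>As z. is_cover E As \<and>
        solves_incidence E As z \<and>
        (\<forall>z'. solves_incidence E As z' \<longrightarrow> z' = z) \<and>
        (\<forall>j < length As. z ! j > 0) \<and>
        corresponds_to E \<pi> As z)"

end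

(* Caratheodory-style descent on the size of the support.  If some nonzero d supported in the
   support of \<pi> satisfies M d = 0, then d has entries of both signs, so one can move from \<pi> in the
   directions d and -d until an entry reaches 0; this writes \<pi> as a mixture of two CAR
   mechanisms with smaller support.  If there is no such d, the columns of the incidence matrix
   of the support are linearly independent, and \<pi> is extreme. *)
theory Submission
  imports Defs
begin

definition car_support :: "'a set \<Rightarrow> ('a set \<Rightarrow> real) \<Rightarrow> 'a set set" where
  "car_support E \<pi> = {A \<in> nonempty_subsets E. \<pi> A > 0}"

text \<open>The kernel of the incidence matrix of the support of \<open>\<pi>\<close>. Its vectors
  are extended by 0 to all nonempty subsets of \<open>E\<close>, so that they can be added to
  \<open>\<pi>\<close> without enumerating columns.\<close>

definition car_null :: "'a set \<Rightarrow> ('a set \<Rightarrow> real) \<Rightarrow> ('a set \<Rightarrow> real) \<Rightarrow> bool" where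
  "car_null E \<pi> d \<longleftrightarrow>
     (\<forall>A \<in> nonempty_subsets E - car_support E \<pi>. d A = 0) \<and>
     (\<forall>x \<in> E. (\<Sum>A \<in> {A \<in> nonempty_subsets E. x \<in> A}. d A) = 0)"

text \<open>Mixtures are built as binary trees because each descent step splits a mechanism into
  exactly two. Equality is asked only on \<open>nonempty_subsets E\<close>, where the values of a
  mechanism have a meaning.\<close>

inductive extreme_mixture :: "'a set \<Rightarrow> ('a set \<Rightarrow> real) \<Rightarrow> bool" for E where
  extreme: "extreme_car_mechanism E \<pi> \<Longrightarrow> extreme_mixture E \<pi>"
| convex: "extreme_mixture E \<sigma> \<Longrightarrow> extreme_mixture E \<tau> \<Longrightarrow> a \<ge> 0 \<Longrightarrow> b \<ge> 0 \<Longrightarrow> a + b = 1 \<Longrightarrow>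
    (\<And>A. A \<in> nonempty_subsets E \<Longrightarrow> \<pi> A = a * \<sigma> A + b * \<tau> A) \<Longrightarrow> extreme_mixture E \<pi>"

lemma finite_nonempty_subsets [simp]: "finite E \<Longrightarrow> finite (nonempty_subsets E)"
  by (simp add: nonempty_subsets_def)

lemma car_support_subset: "car_support E \<pi> \<subseteq> nonempty_subsets E"
  by (auto simp: car_support_def)

lemma finite_car_support [simp]: "finite E \<Longrightarrow> finite (car_support E \<pi>)"
  using car_support_subset finite_nonempty_subsets finite_subset by metis

text \<open>Passes between the column-indexed sums of \<open>solves_incidence\<close> and the
  set-indexed sums of \<open>car_mechanism\<close>. As \<open>As\<close> is distinct,
  \<open>(!) As\<close> is a bijection from the columns onto \<open>set As\<close>; all other sets
  contribute 0.\<close>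

lemma incidence_sum:
  assumes "finite E" "distinct As" "set As \<subseteq> nonempty_subsets E"
    and "\<And>A. A \<in> nonempty_subsets E - set As \<Longrightarrow> g A = 0"
  shows "(\<Sum>j < length As. incidence_matrix As x j * g (As ! j)) =
    (\<Sum>A \<in> {A \<in> nonempty_subsets E. x \<in> A}. g A)"
proof -
  have "(\<Sum>j < length As. incidence_matrix As x j * g (As ! j)) =
      (\<Sum>j < length As. if x \<in> As ! j then g (As ! j) else 0)"
    by (rule sum.cong) (auto simp: incidence_matrix_def)
  also have "\<dots> = (\<Sum>A \<in> set As. if x \<in> A then g A else 0)"
    by (rule sum.reindex_bij_betw[OF bij_betw_nth]) (use assms in auto)
  also have "\<dots> = (\<Sum>A \<in> nonempty_subsets E. if x \<in> A then g A else 0)"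
    by (rule sum.mono_neutral_left) (use assms in auto)
  also have "\<dots> = (\<Sum>A \<in> {A \<in> nonempty_subsets E. x \<in> A}. g A)"
    by (rule sum.inter_filter[symmetric]) (use assms in simp)
  finally show ?thesis .
qed

text \<open>The cover is an enumeration of the support. Two solutions of the incidence equation
  differ by a kernel vector, so a trivial kernel makes the solution unique.\<close>

lemma extreme_if_no_car_null:
  assumes fin: "finite E" and car: "car_mechanism E \<pi>"
    and null: "\<And>d A. car_null E \<pi> d \<Longrightarrow> A \<in> nonempty_subsets E \<Longrightarrow> d A = 0"
  shows "extreme_car_mechanism E \<pi>"
proof -
  obtain As where As: "set As = car_support E \<pi>" "distinct As"
    using finite_distinct_list[OF finite_car_support[OF fin]] by blast
  define z where "z = map \<pi> As"
  have sub: "set As \<subseteq> nonempty_subsets E"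
    using As car_support_subset by metis
  have zero: "\<pi> A = 0" if "A \<in> nonempty_subsets E - set As" for A
    using that car As by (force simp: car_mechanism_def car_support_def)
  \<comment> \<open>At an uncovered point every summand would vanish, yet the row sum is 1.\<close>
  have "x \<in> \<Union> (set As)" if "x \<in> E" for x
  proof (rule ccontr)
    assume "x \<notin> \<Union> (set As)"
    then have "(\<Sum>A \<in> {A \<in> nonempty_subsets E. x \<in> A}. \<pi> A) = 0"
      using zero by (intro sum.neutral) auto
    then show False
      using car that by (simp add: car_mechanism_def)
  qed
  then have cover: "is_cover E As"
    using sub As by (auto simp: is_cover_def nonempty_subsets_def)
  have "(\<Sum>j < length As. incidence_matrix As x j * z ! j) = 1" if "x \<in> E" for x
  proof -
    have "(\<Sum>j < length As. incidence_matrix As x j * z ! j) =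
        (\<Sum>j < length As. incidence_matrix As x j * \<pi> (As ! j))"
      by (simp add: z_def)
    also have "\<dots> = 1"
      using incidence_sum[OF fin As(2) sub, of \<pi>] zero car that
      by (simp add: car_mechanism_def)
    finally show ?thesis .
  qed
  then have solves: "solves_incidence E As z"
    by (simp add: solves_incidence_def z_def)
  have unique: "z' = z" if z': "solves_incidence E As z'" for z'
  proof -
    \<comment> \<open>\<open>f\<close> sends a set of the cover to its column index. It turns the
      list \<open>z'\<close> into a function on sets, so that \<open>d\<close> is the difference of
      the two solutions, extended by 0 off the support.\<close>
    define f where "f = the_inv_into {..<length As} ((!) As)"
    define d where "d A = (if A \<in> set As then z' ! f A - \<pi> A else 0)" for A
    have d_nth: "d (As ! j) = z' ! j - z ! j" if "j < length As" for j
      using that As(2)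
      by (simp add: d_def f_def z_def the_inv_into_f_f inj_on_nth)
    have "(\<Sum>A \<in> {A \<in> nonempty_subsets E. x \<in> A}. d A) = 0" if "x \<in> E" for x
    proof -
      have "(\<Sum>A \<in> {A \<in> nonempty_subsets E. x \<in> A}. d A) =
          (\<Sum>j < length As. incidence_matrix As x j * d (As ! j))"
        by (rule incidence_sum[OF fin As(2) sub, symmetric]) (simp add: d_def)
      also have "\<dots> = (\<Sum>j < length As. incidence_matrix As x j * z' ! j -
          incidence_matrix As x j * z ! j)"
        by (rule sum.cong) (auto simp: d_nth algebra_simps)
      also have "\<dots> = 0"
        using z' solves that by (simp add: sum_subtractf solves_incidence_def)
      finally show ?thesis .
    qed
    then have "car_null E \<pi> d"
      by (simp add: car_null_def d_def As)
    then have "d (As ! j) = 0" if "j < length As" for j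
      using null sub that nth_mem by blast
    then show ?thesis
      using z' by (intro nth_equalityI) (auto simp: d_nth solves_incidence_def z_def)
  qed
  have pos: "z ! j > 0" if "j < length As" for j
    using that As nth_mem[OF that] by (simp add: z_def car_support_def)
  have "corresponds_to E \<pi> As z"
    using zero by (simp add: corresponds_to_def z_def)
  then show ?thesis
    unfolding extreme_car_mechanism_def using car cover solves unique pos by blast
qed

lemma car_null_uminus: "car_null E \<pi> d \<Longrightarrow> car_null E \<pi> (\<lambda>A. - d A)"
  by (simp add: car_null_def sum_negf)

text \<open>Only the negative entries of \<open>d\<close> limit a move from \<open>\<pi>\<close> in
  direction \<open>d\<close>. Stopping when the first of them is used up removes a set from the
  support, while the row sums stay 1 because those of \<open>d\<close> are 0.\<close>

lemma car_null_shrink_support: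
  assumes fin: "finite E" and car: "car_mechanism E \<pi>" and null: "car_null E \<pi> d"
    and nz: "B \<in> nonempty_subsets E" "d B \<noteq> 0"
  obtains t where "t > 0" "car_mechanism E (\<lambda>A. \<pi> A + t * d A)"
    "car_support E (\<lambda>A. \<pi> A + t * d A) \<subset> car_support E \<pi>"
proof -
  define N where "N = {A \<in> nonempty_subsets E. d A < 0}"
  have supp: "\<pi> A > 0" if "A \<in> nonempty_subsets E" "d A \<noteq> 0" for A
    using null that by (auto simp: car_null_def car_support_def)
  have finN: "finite N"
    using fin by (simp add: N_def)
  \<comment> \<open>Otherwise the row of a point of \<open>B\<close> is a vanishing sum of
    nonnegative terms, which forces \<open>d B = 0\<close>.\<close>
  have "N \<noteq> {}"
  proof
    assume "N = {}"
    then have nonneg: "d A \<ge> 0" if "A \<in> nonempty_subsets E" for A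
      using that by (force simp: N_def)
    obtain x where x: "x \<in> B" "x \<in> E"
      using nz by (auto simp: nonempty_subsets_def)
    have "(\<Sum>A \<in> {A \<in> nonempty_subsets E. x \<in> A}. d A) = 0"
      using null x by (simp add: car_null_def)
    then have "d B = 0"
      using sum_nonneg_0[of "{A \<in> nonempty_subsets E. x \<in> A}" d B] fin x nz nonneg by auto
    then show False
      using nz by simp
  qed
  \<comment> \<open>For \<open>A\<close> in \<open>N\<close>, the entry
    \<open>\<pi> A + r * d A\<close> reaches 0 at \<open>r = \<pi> A / - d A\<close>; the minimum is
    the first such \<open>r\<close>. The set \<open>C\<close> attaining it leaves the
    support.\<close>
  define t where "t = Min ((\<lambda>A. \<pi> A / - d A) ` N)"
  have "t \<in> (\<lambda>A. \<pi> A / - d A) ` N"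
    unfolding t_def using finN \<open>N \<noteq> {}\<close> by (intro Min_in) auto
  then obtain C where C: "C \<in> N" "t = \<pi> C / - d C"
    by blast
  have "t > 0"
    using C supp[of C] by (simp add: N_def divide_pos_neg)
  have nonneg: "\<pi> A + t * d A \<ge> 0" if A: "A \<in> nonempty_subsets E" for A
  proof (cases "d A < 0")
    case True
    then have "t \<le> \<pi> A / - d A"
      unfolding t_def using finN A by (intro Min_le) (auto simp: N_def)
    then have "t * - d A \<le> \<pi> A"
      using True by (subst (asm) pos_le_divide_eq) auto
    then show ?thesis
      by simp
  next
    case False
    then show ?thesis
      using A car \<open>t > 0\<close> by (simp add: car_mechanism_def)
  qed
  have "car_mechanism E (\<lambda>A. \<pi> A + t * d A)"
    using car null nonneg
    by (simp add: car_mechanism_def car_null_def sum.distrib flip: sum_distrib_left)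
  \<comment> \<open>No set enters the support, since \<open>d\<close> is nonzero only where
    \<open>\<pi>\<close> is already positive.\<close>
  moreover have "car_support E (\<lambda>A. \<pi> A + t * d A) \<subseteq> car_support E \<pi>"
    using supp by (force simp: car_support_def)
  moreover have "C \<in> car_support E \<pi>" "C \<notin> car_support E (\<lambda>A. \<pi> A + t * d A)"
    using C supp[of C] by (auto simp: car_support_def N_def)
  ultimately show ?thesis
    using that \<open>t > 0\<close> by blast
qed

lemma car_mechanism_extreme_mixture:
  assumes "finite E" and "car_mechanism E \<pi>"
  shows "extreme_mixture E \<pi>"
  using assms(2)
proof (induction "card (car_support E \<pi>)" arbitrary: \<pi> rule: less_induct)
  case less
  show ?case
  proof (cases "\<exists>d B. car_null E \<pi> d \<and> B \<in> nonempty_subsets E \<and> d B \<noteq> 0")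
    case False
    then show ?thesis
      using extreme_if_no_car_null[OF assms(1) less.prems] extreme_mixture.extreme by blast
  next
    case True
    then obtain d B where d: "car_null E \<pi> d" "B \<in> nonempty_subsets E" "d B \<noteq> 0"
      by blast
    obtain s where s: "s > 0" "car_mechanism E (\<lambda>A. \<pi> A + s * d A)"
      "car_support E (\<lambda>A. \<pi> A + s * d A) \<subset> car_support E \<pi>"
      using car_null_shrink_support[OF assms(1) less.prems d] .
    obtain t where t: "t > 0" "car_mechanism E (\<lambda>A. \<pi> A + t * - d A)"
      "car_support E (\<lambda>A. \<pi> A + t * - d A) \<subset> car_support E \<pi>"
      using car_null_shrink_support[OF assms(1) less.prems car_null_uminus[OF d(1)] d(2)] d(3)
      by auto
    have "extreme_mixture E (\<lambda>A. \<pi> A + s * d A)" "extreme_mixture E (\<lambda>A. \<pi> A + t * - d A)"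
      using s t assms(1) by (auto intro!: less.hyps psubset_card_mono)
    then show ?thesis
    \<comment> \<open>\<open>\<pi>\<close> lies between the two new mechanisms, at distance
      \<open>s\<close> along \<open>d\<close> and \<open>t\<close> along \<open>-d\<close>. The
      weights are therefore crossed: the terms \<open>t * s * d A\<close> and
      \<open>s * t * d A\<close> cancel.\<close>
    proof (rule extreme_mixture.convex[where a = "t / (s + t)" and b = "s / (s + t)"])
      fix A
      have "\<pi> A * (s + t) = t * (\<pi> A + s * d A) + s * (\<pi> A + t * - d A)"
        by (simp add: algebra_simps)
      then have "\<pi> A = (t * (\<pi> A + s * d A) + s * (\<pi> A + t * - d A)) / (s + t)"
        using s(1) t(1) by (simp add: eq_divide_eq)
      then show "\<pi> A = t / (s + t) * (\<pi> A + s * d A) + s / (s + t) * (\<pi> A + t * - d A)"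
        by (simp add: add_divide_distrib)
    qed (use s(1) t(1) in \<open>auto simp flip: add_divide_distrib\<close>)
  qed
qed

text \<open>Flattens the tree of binary mixtures: at each node the two lists are concatenated after
  scaling their weights by \<open>a\<close> and \<open>b\<close>. A mechanism may occur several
  times in the result.\<close>

lemma extreme_mixture_list:
  assumes "extreme_mixture E \<pi>"
  shows "\<exists>ws :: (real \<times> ('a set \<Rightarrow> real)) list.
    (\<forall>(w, \<rho>) \<in> set ws. w \<ge> 0 \<and> extreme_car_mechanism E \<rho>) \<and>
    (\<Sum>(w, \<rho>) \<leftarrow> ws. w) = 1 \<and>
    (\<forall>A \<in> nonempty_subsets E. \<pi> A = (\<Sum>(w, \<rho>) \<leftarrow> ws. w * \<rho> A))"
  using assms
proof induction
  case (extreme \<pi>)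
  then show ?case
    by (intro exI[of _ "[(1, \<pi>)]"]) simp
next
  case (convex \<sigma> \<tau> a b \<pi>)
  from convex.IH obtain us vs :: "(real \<times> ('a set \<Rightarrow> real)) list" where
    us: "\<forall>(w, \<rho>) \<in> set us. w \<ge> 0 \<and> extreme_car_mechanism E \<rho>" "(\<Sum>(w, \<rho>) \<leftarrow> us. w) = 1"
      "\<forall>A \<in> nonempty_subsets E. \<sigma> A = (\<Sum>(w, \<rho>) \<leftarrow> us. w * \<rho> A)" and
    vs: "\<forall>(w, \<rho>) \<in> set vs. w \<ge> 0 \<and> extreme_car_mechanism E \<rho>" "(\<Sum>(w, \<rho>) \<leftarrow> vs. w) = 1"
      "\<forall>A \<in> nonempty_subsets E. \<tau> A = (\<Sum>(w, \<rho>) \<leftarrow> vs. w * \<rho> A)"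
    by blast
  let ?scale = "\<lambda>c. map (\<lambda>(w :: real, \<rho> :: 'a set \<Rightarrow> real). (c * w, \<rho>))"
  \<comment> \<open>Taking \<open>h\<close> as evaluation at a set \<open>A\<close> gives the
    mixture equation, and \<open>h\<close> constantly 1 gives the total weight.\<close>
  have sum_scale: "(\<Sum>(w, \<rho>) \<leftarrow> ?scale c xs. w * h \<rho>) = c * (\<Sum>(w, \<rho>) \<leftarrow> xs. w * h \<rho>)"
    for c h xs
    by (induction xs) (auto simp: algebra_simps)
  have sum_scale_1: "(\<Sum>(w, \<rho>) \<leftarrow> ?scale c xs. w) = c * (\<Sum>(w, \<rho>) \<leftarrow> xs. w)" for c xs
    using sum_scale[of "\<lambda>_. 1"] by simp
  show ?case
  proof (intro exI[of _ "?scale a us @ ?scale b vs"] conjI)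
    show "\<forall>(w, \<rho>) \<in> set (?scale a us @ ?scale b vs). w \<ge> 0 \<and> extreme_car_mechanism E \<rho>"
      using us(1) vs(1) convex.hyps by auto
    show "(\<Sum>(w, \<rho>) \<leftarrow> ?scale a us @ ?scale b vs. w) = 1"
      unfolding map_append sum_list_append sum_scale_1 using us(2) vs(2) convex.hyps by simp
    show "\<forall>A \<in> nonempty_subsets E.
        \<pi> A = (\<Sum>(w, \<rho>) \<leftarrow> ?scale a us @ ?scale b vs. w * \<rho> A)"
      unfolding map_append sum_list_append sum_scale using us(3) vs(3) convex.hyps by simp
  qed
qed

theorem theorem1:
  fixes E :: "'a set" and \<pi> :: "'a set \<Rightarrow> real"
  assumes "finite E" and "E \<noteq> {}"
    and "car_mechanism E \<pi>"
  shows "\<exists>(p::nat) (\<pi>s :: nat \<Rightarrow> 'a set \<Rightarrow> real) (l :: nat \<Rightarrow> real).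
           p \<ge> 1 \<and>
           (\<forall>i \<in> {1..p}. extreme_car_mechanism E (\<pi>s i)) \<and>
           (\<forall>i \<in> {1..p}. l i \<ge> 0) \<and>
           (\<Sum>i = 1..p. l i) = 1 \<and>
           (\<forall>A \<in> nonempty_subsets E. \<pi> A = (\<Sum>i = 1..p. l i * \<pi>s i A))"
proof -
  obtain ws :: "(real \<times> ('a set \<Rightarrow> real)) list" where
    ws: "\<forall>(w, \<rho>) \<in> set ws. w \<ge> 0 \<and> extreme_car_mechanism E \<rho>" "(\<Sum>(w, \<rho>) \<leftarrow> ws. w) = 1"
      "\<forall>A \<in> nonempty_subsets E. \<pi> A = (\<Sum>(w, \<rho>) \<leftarrow> ws. w * \<rho> A)"
    using extreme_mixture_list[OF car_mechanism_extreme_mixture[OF assms(1,3)]] by blast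
  have nth: "0 \<le> fst (ws ! i) \<and> extreme_car_mechanism E (snd (ws ! i))" if "i < length ws" for i
    using ws(1) nth_mem[OF that] by (simp add: case_prod_beta)
  \<comment> \<open>List positions start at 0 but the mixture is indexed from 1, hence
    \<open>i - 1\<close>. A general \<open>f\<close> covers both the sum of the weights and the
    mixture itself.\<close>
  have shift: "(\<Sum>(w, \<rho>) \<leftarrow> ws. f w \<rho>) =
      (\<Sum>i = 1..length ws. f (fst (ws ! (i - 1))) (snd (ws ! (i - 1))))"
    for f :: "real \<Rightarrow> ('a set \<Rightarrow> real) \<Rightarrow> real"
    by (simp add: sum_list_sum_nth case_prod_beta sum.atLeast1_atMost_eq atLeast0LessThan)
  \<comment> \<open>The weights of an empty list would sum to 0 instead of 1.\<close>
  have "ws \<noteq> []"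
    using ws(2) by auto
  then have "length ws \<ge> 1"
    by (simp add: Suc_le_eq)
  then show ?thesis
    using ws(2,3) unfolding shift
    by (intro exI[of _ "length ws"] exI[of _ "\<lambda>i. snd (ws ! (i - 1))"]
        exI[of _ "\<lambda>i. fst (ws ! (i - 1))"]) (use nth in auto)
qed

end
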